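(* For each $k\in\mathbb{N}$, the set $\mathcal{SF}(k)$ of all (isomorphism classes of) finite non-abelian groups $G$ whose commuting graph $\Gamma(G)$ has maximum vertex degree $<k$ is finite.
   Context: For a finite non-abelian group $G$ with center $Z(G)$, the commuting graph $\Gamma(G)$ is the simple graph whose vertex set is $G\setminus Z(G)$ and in which two distinct vertices $x,y$ are adjacent if and only if $xy=yx$. *)

theory Defs
  imports "HOL-Algebra.Algebra" "Graph_Theory.Pair_Digraph"
begin

definition center :: "('a, 'b) monoid_scheme \<Rightarrow> 'a set" where
  "center G = {z \<in> carrier G. \<forall>g \<in> carrier G. z \<otimes>\<^bsub>G\<^esub> g = g \<otimes>\<^bsub>G\<^esub> z}"

text \<open>As usual in \<open>Graph_Theory\<close>, a simple graph is a loop-free symmetric digraph without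
  parallel arcs: the edge \<open>xy\<close> is the pair of arcs \<open>(x, y)\<close>, \<open>(y, x)\<close>.\<close>

definition commuting_graph :: "('a, 'b) monoid_scheme \<Rightarrow> 'a pair_pre_digraph" where
  "commuting_graph G =
     \<lparr> pverts = carrier G - center G,
       parcs = {(x, y). x \<in> carrier G - center G \<and> y \<in> carrier G - center G \<and>
                        x \<noteq> y \<and> x \<otimes>\<^bsub>G\<^esub> y = y \<otimes>\<^bsub>G\<^esub> x} \<rparr>"

lemma pair_graph_commuting_graph:
  assumes "finite (carrier G)"
  shows "pair_graph (commuting_graph G)"
proof
  show "finite (parcs (commuting_graph G))"
    by (rule finite_subset[of _ "carrier G \<times> carrier G"])
       (auto simp: commuting_graph_def assms)
qed (auto simp: commuting_graph_def assms symmetric_def sym_def)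

text \<open>In a symmetric digraph the degree of a vertex is its out-degree. \<open>Max\<close> is only
  meaningful for a finite graph with at least one vertex; this is the case for the commuting
  graph of a finite non-abelian group.\<close>

definition max_degree :: "'a pair_pre_digraph \<Rightarrow> nat" where
  "max_degree \<Gamma> = Max (out_degree (with_proj \<Gamma>) ` pverts \<Gamma>)"

lemma (in group) commuting_graph_nonempty:
  assumes "\<not> comm_group G"
  shows "pverts (commuting_graph G) \<noteq> {}"
proof
  assume "pverts (commuting_graph G) = {}"
  then have "\<And>x y. x \<in> carrier G \<Longrightarrow> y \<in> carrier G \<Longrightarrow> x \<otimes> y = y \<otimes> x"
    by (auto simp: commuting_graph_def center_def)
  then have "comm_group G" by (rule group_comm_groupI)
  with assms show False ..
qed

definition SF_groups :: "nat \<Rightarrow> 'a monoid set" where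
  "SF_groups k = {G. group G \<and> finite (carrier G) \<and> \<not> comm_group G \<and>
                     max_degree (commuting_graph G) < k}"

definition iso_rel :: "'a monoid set \<Rightarrow> 'a monoid rel" where
  "iso_rel \<G> = {(G, H). G \<in> \<G> \<and> H \<in> \<G> \<and> G \<cong> H}"

lemma equiv_iso_rel:
  assumes "\<And>G. G \<in> \<G> \<Longrightarrow> group G"
  shows "equiv \<G> (iso_rel \<G>)"
  by (rule equivI)
     (auto simp: iso_rel_def refl_on_def sym_def trans_def
           intro: group.iso_sym[OF assms] iso_trans)

text \<open>The carriers range over a type \<open>'a\<close>. The instance \<open>'a = nat\<close> already covers all finite
  groups up to isomorphism, see \<open>SF_groups_nat_representative\<close> below.\<close>

definition SF :: "nat \<Rightarrow> 'a monoid set set" where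
  "SF k = SF_groups k // iso_rel (SF_groups k)"

lemma out_degree_commuting_graph:
  assumes "x \<in> carrier G - center G"
  shows "out_degree (with_proj (commuting_graph G)) x =
         card {y \<in> carrier G - center G. x \<noteq> y \<and> x \<otimes>\<^bsub>G\<^esub> y = y \<otimes>\<^bsub>G\<^esub> x}"
proof -
  have "out_arcs (with_proj (commuting_graph G)) x =
        Pair x ` {y \<in> carrier G - center G. x \<noteq> y \<and> x \<otimes>\<^bsub>G\<^esub> y = y \<otimes>\<^bsub>G\<^esub> x}"
    using assms by (auto simp: out_arcs_def commuting_graph_def)
  then show ?thesis
    by (simp add: out_degree_def card_image inj_on_def)
qed

lemma iso_commutes_iff:
  assumes G: "group G" and f: "f \<in> iso G H" and x: "x \<in> carrier G" and y: "y \<in> carrier G"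
  shows "f x \<otimes>\<^bsub>H\<^esub> f y = f y \<otimes>\<^bsub>H\<^esub> f x \<longleftrightarrow> x \<otimes>\<^bsub>G\<^esub> y = y \<otimes>\<^bsub>G\<^esub> x"
proof -
  have h: "f \<in> hom G H" and i: "inj_on f (carrier G)"
    using f by (auto simp: iso_def bij_betw_def)
  have "x \<otimes>\<^bsub>G\<^esub> y \<in> carrier G" "y \<otimes>\<^bsub>G\<^esub> x \<in> carrier G"
    using G x y by (auto intro: monoid.m_closed group.is_monoid)
  then show ?thesis
    using hom_mult[OF h x y] hom_mult[OF h y x] inj_onD[OF i] by metis
qed

lemma iso_noncentral_image:
  assumes G: "group G" and f: "f \<in> iso G H"
  shows "f ` (carrier G - center G) = carrier H - center H"
proof -
  have s: "carrier H = f ` carrier G" and i: "inj_on f (carrier G)"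
    using f by (auto simp: iso_def bij_betw_def)
  have "f x \<in> center H \<longleftrightarrow> x \<in> center G" if "x \<in> carrier G" for x
    using that iso_commutes_iff[OF G f that] by (auto simp: center_def s)
  then show ?thesis unfolding s by (auto simp: center_def)
qed

lemma max_degree_iso:
  assumes G: "group G" and f: "f \<in> iso G H"
  shows "max_degree (commuting_graph G) = max_degree (commuting_graph H)"
proof -
  have i: "inj_on f (carrier G)"
    using f by (auto simp: iso_def bij_betw_def)
  note im = iso_noncentral_image[OF G f]
  have "out_degree (with_proj (commuting_graph H)) (f x) =
        out_degree (with_proj (commuting_graph G)) x"
    if x: "x \<in> carrier G - center G" for x
  proof -
    let ?N = "{y \<in> carrier G - center G. x \<noteq> y \<and> x \<otimes>\<^bsub>G\<^esub> y = y \<otimes>\<^bsub>G\<^esub> x}"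
    have fx: "f x \<in> carrier H - center H" using x im by blast
    have "{y \<in> carrier H - center H. f x \<noteq> y \<and> f x \<otimes>\<^bsub>H\<^esub> y = y \<otimes>\<^bsub>H\<^esub> f x} = f ` ?N"
      unfolding im[symmetric]
      using x iso_commutes_iff[OF G f, of x] inj_onD[OF i] by auto
    moreover have "card (f ` ?N) = card ?N"
      by (rule card_image) (rule inj_on_subset[OF i], auto)
    ultimately show ?thesis
      by (simp only: out_degree_commuting_graph[OF fx] out_degree_commuting_graph[OF x])
  qed
  then have "out_degree (with_proj (commuting_graph H)) ` f ` (carrier G - center G) =
             out_degree (with_proj (commuting_graph G)) ` (carrier G - center G)"
    unfolding image_image by (rule image_cong[OF refl])
  then show ?thesis
    unfolding max_degree_def by (simp add: commuting_graph_def im)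
qed

lemma SF_groups_iso:
  assumes "G \<in> SF_groups k" "group H" "G \<cong> H"
  shows "H \<in> SF_groups k"
proof -
  obtain f where f: "f \<in> iso G H" using assms(3) by (auto simp: is_iso_def)
  have G: "group G" using assms(1) by (simp add: SF_groups_def)
  have "\<not> comm_group H"
  proof
    assume "comm_group H"
    then interpret H: comm_group H .
    have "x \<otimes>\<^bsub>G\<^esub> y = y \<otimes>\<^bsub>G\<^esub> x" if "x \<in> carrier G" "y \<in> carrier G" for x y
      using that iso_commutes_iff[OF G f that] f
      by (auto simp: iso_def hom_def intro!: H.m_comm)
    then have "comm_group G" by (rule group.group_comm_groupI[OF G])
    then show False using assms(1) by (simp add: SF_groups_def)
  qed
  moreover have "finite (carrier H)"
    using f assms(1) bij_betw_finite[of f "carrier G" "carrier H"]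
    by (simp add: iso_def SF_groups_def)
  ultimately show ?thesis
    using assms max_degree_iso[OF G f] by (simp add: SF_groups_def)
qed

lemma SF_groups_nat_representative:
  fixes G :: "'a monoid"
  assumes "G \<in> SF_groups k"
  shows "\<exists>H :: nat monoid. H \<in> SF_groups k \<and> G \<cong> H"
proof -
  interpret group G using assms by (simp add: SF_groups_def)
  obtain f :: "'a \<Rightarrow> nat" where f: "inj_on f (carrier G)"
    using assms finite_imp_inj_to_nat_seg[of "carrier G"] by (auto simp: SF_groups_def)
  have "group (image_group f G)" "f \<in> iso G (image_group f G)"
    using inj_imp_image_group_is_group[OF f] inj_imp_image_group_iso[OF f] by auto
  then show ?thesis
    using SF_groups_iso[OF assms] by (auto intro: is_isoI)
qed

end

theory Submission
  imports Defs
begin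

text \<open>
  The order of a non-abelian group \<open>G\<close> of maximum degree \<open>< k\<close> is bounded in terms of \<open>k\<close>, and
  there are only finitely many groups of bounded order up to isomorphism.

  For the bound, let \<open>Z\<close> be the center and \<open>x\<close> a noncentral element. The coset \<open>xZ\<close> consists of
  noncentral elements commuting with \<open>x\<close>, so \<open>\<bar>Z\<bar> - 1\<close> is at most the degree of \<open>x\<close>, whence
  \<open>\<bar>Z\<bar> \<le> k\<close>. The centralizer of \<open>x\<close> consists of \<open>Z\<close>, of \<open>x\<close> and of the neighbours of \<open>x\<close>, so it has
  at most \<open>2k\<close> elements, and its order divides \<open>L = (2k)!\<close>. The class equation then bounds \<open>\<bar>G\<bar>\<close>:
  every noncentral conjugacy class has size \<open>\<bar>G\<bar> / c\<close> with \<open>c\<close> dividing \<open>L\<close>, so \<open>\<bar>G\<bar>\<close> divides \<open>L\<close>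
  times the size of each of them and therefore \<open>L (\<bar>G\<bar> - \<bar>Z\<bar>)\<close>. Hence \<open>\<bar>G\<bar>\<close> divides \<open>L \<bar>Z\<bar>\<close>, and
  \<open>\<bar>G\<bar> \<le> (2k)! k\<close>.

  For the finiteness, a group of order at most \<open>N\<close> has a multiplication table on numbers below
  \<open>N\<close>. The table determines the group up to isomorphism, and there are finitely many tables.
\<close>

section \<open>The class equation\<close>

text \<open>By the orbit-stabilizer theorem \<open>\<bar>G\<bar>\<close> divides \<open>L\<close> times the size of each orbit in \<open>A\<close>, and
  \<open>A\<close> is the disjoint union of these orbits.\<close>

lemma (in group_action) order_dvd_mult_card_invariant_set:
  assumes "finite A" and "A \<subseteq> E"
    and invariant: "\<And>x. x \<in> A \<Longrightarrow> orbit G \<phi> x \<subseteq> A"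
    and stabilizers: "\<And>x. x \<in> A \<Longrightarrow> card (stabilizer G \<phi> x) dvd L"
  shows "order G dvd L * card A"
proof -
  let ?C = "orbit G \<phi> ` A"
  have "\<Union>?C = A"
    using invariant orbit_refl \<open>A \<subseteq> E\<close> by blast
  moreover have "card (\<Union>?C) = sum card ?C"
  proof (rule card_Union_disjoint)
    have "?C \<subseteq> orbits G E \<phi>"
      using \<open>A \<subseteq> E\<close> by (auto simp: orbits_def)
    then show "pairwise disjnt ?C"
      unfolding pairwise_def disjnt_def using disjoint_union by (meson subsetD)
  next
    show "finite B" if "B \<in> ?C" for B
      using that invariant \<open>finite A\<close> by (auto intro: finite_subset)
  qed
  ultimately have "L * card A = (\<Sum>B\<in>?C. L * card B)"
    by (simp add: sum_distrib_left)
  moreover have "order G dvd L * card (orbit G \<phi> x)" if "x \<in> A" for x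
  proof -
    from stabilizers[OF that] obtain q where "L = card (stabilizer G \<phi> x) * q"
      by (rule dvdE)
    moreover have "card (orbit G \<phi> x) * card (stabilizer G \<phi> x) = order G"
      using orbit_stabilizer_theorem that \<open>A \<subseteq> E\<close> by blast
    ultimately have "L * card (orbit G \<phi> x) = order G * q"
      by (metis mult.commute mult.left_commute)
    then show ?thesis by simp
  qed
  ultimately show ?thesis
    by (auto intro!: dvd_sum)
qed

definition centralizer :: "('a, 'b) monoid_scheme \<Rightarrow> 'a \<Rightarrow> 'a set" where
  "centralizer G x = {g \<in> carrier G. x \<otimes>\<^bsub>G\<^esub> g = g \<otimes>\<^bsub>G\<^esub> x}"

context group
begin

lemma conjugate_eq_iff:
  assumes "g \<in> carrier G" "x \<in> carrier G" "y \<in> carrier G"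
  shows "g \<otimes> x \<otimes> inv g = y \<longleftrightarrow> g \<otimes> x = y \<otimes> g"
  using assms by (metis inv_solve_right m_closed)

lemma stabilizer_conjugation:
  assumes "x \<in> carrier G"
  shows "stabilizer G (\<lambda>g. \<lambda>h \<in> carrier G. g \<otimes> h \<otimes> inv g) x = centralizer G x"
  using assms conjugate_eq_iff[of _ x x] by (auto simp: stabilizer_def centralizer_def)

lemma noncentral_conjugate:
  assumes "g \<in> carrier G" "x \<in> carrier G - center G"
  shows "g \<otimes> x \<otimes> inv g \<in> carrier G - center G"
proof -
  have x: "x \<in> carrier G" using assms by simp
  let ?y = "g \<otimes> x \<otimes> inv g"
  have y: "?y \<in> carrier G" using assms x by simp
  have "?y \<notin> center G"
  proof
    assume c: "?y \<in> center G"
    then have "g \<otimes> x = g \<otimes> ?y"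
      using conjugate_eq_iff[OF assms(1) x y] assms(1) by (auto simp: center_def)
    then have "x = ?y" using assms(1) x y by simp
    with c assms(2) show False by simp
  qed
  with y show ?thesis by simp
qed

text \<open>Summing over the noncentral classes shows that \<open>\<bar>G\<bar>\<close> divides \<open>L (\<bar>G\<bar> - \<bar>Z\<bar>)\<close>. As it also
  divides \<open>L \<bar>G\<bar>\<close>, it divides the difference.\<close>

lemma order_dvd_mult_card_center:
  assumes fin: "finite (carrier G)"
    and centralizers: "\<And>x. x \<in> carrier G - center G \<Longrightarrow> card (centralizer G x) dvd L"
  shows "order G dvd L * card (center G)"
proof -
  interpret conj: group_action G "carrier G" "\<lambda>g. \<lambda>h \<in> carrier G. g \<otimes> h \<otimes> inv g"
    by (rule action_by_conjugation)
  have sub: "center G \<subseteq> carrier G" by (auto simp: center_def)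
  have "order G dvd L * card (carrier G - center G)"
  proof (rule conj.order_dvd_mult_card_invariant_set)
    show "orbit G (\<lambda>g. \<lambda>h \<in> carrier G. g \<otimes> h \<otimes> inv g) x \<subseteq> carrier G - center G"
      if "x \<in> carrier G - center G" for x
      using that noncentral_conjugate by (auto simp: orbit_def)
  qed (use fin stabilizer_conjugation centralizers in auto)
  moreover have "L * card (carrier G - center G) + L * card (center G) = L * order G"
    using card_mono[OF fin sub]
    by (simp add: order_def card_Diff_subset[OF finite_subset[OF sub fin] sub] flip: distrib_left)
  ultimately show ?thesis
    by (metis dvd_add_right_iff dvd_triv_right)
qed

section \<open>Bounding the order by the degree\<close>

lemma noncentral_mult_center:
  assumes "x \<in> carrier G - center G" "z \<in> center G"
  shows "x \<otimes> z \<in> carrier G - center G" and "x \<otimes> (x \<otimes> z) = (x \<otimes> z) \<otimes> x"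
proof -
  have x: "x \<in> carrier G" and z: "z \<in> carrier G" using assms by (auto simp: center_def)
  have zc: "z \<otimes> g = g \<otimes> z" if "g \<in> carrier G" for g
    using assms(2) that by (simp add: center_def)
  show "x \<otimes> (x \<otimes> z) = (x \<otimes> z) \<otimes> x"
    using x z zc by (simp add: m_assoc)
  have "x \<in> center G" if c: "x \<otimes> z \<in> center G"
  proof -
    have "x \<otimes> g = g \<otimes> x" if g: "g \<in> carrier G" for g
    proof -
      have "(x \<otimes> g) \<otimes> z = (x \<otimes> z) \<otimes> g" using x z g zc by (simp add: m_assoc)
      also have "\<dots> = (g \<otimes> x) \<otimes> z" using c x z g by (simp add: center_def m_assoc)
      finally show ?thesis using x z g by simp
    qed
    with x show ?thesis by (simp add: center_def)
  qed
  with assms(1) x z show "x \<otimes> z \<in> carrier G - center G" by auto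
qed

text \<open>The coset \<open>xZ\<close> without \<open>x\<close> itself lies among the neighbours of \<open>x\<close>.\<close>

lemma card_center_le_degree:
  assumes fin: "finite (carrier G)" and x: "x \<in> carrier G - center G"
  shows "card (center G) \<le> Suc (out_degree (with_proj (commuting_graph G)) x)"
proof -
  let ?N = "{y \<in> carrier G - center G. x \<noteq> y \<and> x \<otimes> y = y \<otimes> x}"
  have "card (center G) = card ((\<lambda>z. x \<otimes> z) ` center G)"
    using x by (intro card_image[symmetric] inj_on_subset[OF inj_on_cmult]) (auto simp: center_def)
  also have "\<dots> \<le> card (insert x ?N)"
    using fin noncentral_mult_center[OF x] by (intro card_mono) auto
  also have "\<dots> \<le> Suc (card ?N)"
    by (rule card_insert_le_m1[THEN order_trans]) auto
  finally show ?thesis by (simp only: out_degree_commuting_graph[OF x])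
qed

lemma card_centralizer:
  assumes fin: "finite (carrier G)" and x: "x \<in> carrier G - center G"
  shows "card (centralizer G x) =
         card (center G) + Suc (out_degree (with_proj (commuting_graph G)) x)"
proof -
  let ?N = "{y \<in> carrier G - center G. x \<noteq> y \<and> x \<otimes> y = y \<otimes> x}"
  have "centralizer G x = center G \<union> insert x ?N"
    using x by (auto simp: centralizer_def center_def)
  also have "card \<dots> = card (center G) + card (insert x ?N)"
    using x fin by (intro card_Un_disjoint) (auto simp: center_def)
  also have "card (insert x ?N) = Suc (card ?N)"
    using fin by simp
  finally show ?thesis by (simp only: out_degree_commuting_graph[OF x])
qed

lemma order_le_of_max_degree:
  assumes fin: "finite (carrier G)" and "\<not> comm_group G"
    and deg: "max_degree (commuting_graph G) < k"
  shows "order G \<le> fact (2 * k) * k"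
proof -
  let ?d = "out_degree (with_proj (commuting_graph G))"
  have verts: "pverts (commuting_graph G) = carrier G - center G"
    by (simp add: commuting_graph_def)
  have d: "Suc (?d x) \<le> k" if "x \<in> carrier G - center G" for x
  proof -
    have "?d x \<le> max_degree (commuting_graph G)"
      unfolding max_degree_def verts using that fin by (intro Max_ge) auto
    with deg show ?thesis by simp
  qed
  obtain x where x: "x \<in> carrier G - center G"
    using commuting_graph_nonempty[OF assms(2)] verts by blast
  have m: "card (center G) \<le> k"
    using card_center_le_degree[OF fin x] d[OF x] by simp
  have "order G dvd fact (2 * k) * card (center G)"
  proof (rule order_dvd_mult_card_center[OF fin])
    show "card (centralizer G y) dvd fact (2 * k)" if "y \<in> carrier G - center G" for y
      using card_centralizer[OF fin that] d[OF that] m by (intro dvd_fact) auto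
  qed
  moreover have "card (center G) > 0"
    using fin by (auto simp: card_gt_0_iff center_def)
  ultimately have "order G \<le> fact (2 * k) * card (center G)"
    by (intro dvd_imp_le) auto
  also have "\<dots> \<le> fact (2 * k) * k"
    using m by simp
  finally show ?thesis .
qed

end

section \<open>Finitely many groups of bounded order\<close>

text \<open>As a set of triples, a table with entries below \<open>N\<close> is one of finitely many subsets of
  \<open>{..<N}\<^sup>3\<close>.\<close>

definition mult_table :: "('a, 'b) monoid_scheme \<Rightarrow> ('a \<Rightarrow> nat) \<Rightarrow> (nat \<times> nat \<times> nat) set" where
  "mult_table G f = {(f a, f b, f (a \<otimes>\<^bsub>G\<^esub> b)) | a b. a \<in> carrier G \<and> b \<in> carrier G}"

text \<open>The first components of the table are the labels of the elements, so both groups use the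
  same labels, and matching equal labels is the isomorphism.\<close>

lemma iso_of_mult_table_eq:
  assumes "group G" "group H" and f: "inj_on f (carrier G)" and g: "inj_on g (carrier H)"
    and eq: "mult_table G f = mult_table H g"
  shows "G \<cong> H"
proof -
  interpret G: group G by fact
  interpret H: group H by fact
  have "fst ` mult_table G f = f ` carrier G" "fst ` mult_table H g = g ` carrier H"
    unfolding mult_table_def by (force intro: G.one_closed H.one_closed)+
  with eq have im: "f ` carrier G = g ` carrier H" by simp
  define h where "h = inv_into (carrier H) g \<circ> f"
  have gh: "g (h a) = f a" and h: "h a \<in> carrier H" if "a \<in> carrier G" for a
  proof -
    have "f a \<in> g ` carrier H" using that im by blast
    then show "g (h a) = f a" "h a \<in> carrier H"
      by (auto simp only: h_def o_apply f_inv_into_f inv_into_into)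
  qed
  have "bij_betw h (carrier G) (carrier H)"
    unfolding h_def
  proof (rule bij_betw_trans)
    show "bij_betw f (carrier G) (g ` carrier H)" using f im by (simp add: bij_betw_def)
    show "bij_betw (inv_into (carrier H) g) (g ` carrier H) (carrier H)"
      using g by (intro bij_betw_inv_into) (simp add: bij_betw_def)
  qed
  moreover have "h (a \<otimes>\<^bsub>G\<^esub> b) = h a \<otimes>\<^bsub>H\<^esub> h b" if "a \<in> carrier G" "b \<in> carrier G" for a b
  proof -
    have "(f a, f b, f (a \<otimes>\<^bsub>G\<^esub> b)) \<in> mult_table H g"
      unfolding eq[symmetric] using that by (auto simp: mult_table_def)
    then obtain c d where c: "c \<in> carrier H" and d: "d \<in> carrier H"
      and e: "f a = g c" "f b = g d" "f (a \<otimes>\<^bsub>G\<^esub> b) = g (c \<otimes>\<^bsub>H\<^esub> d)"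
      by (auto simp: mult_table_def)
    have "h a = c" "h b = d"
      using e(1,2) gh h that c d inj_onD[OF g] by metis+
    moreover have "h (a \<otimes>\<^bsub>G\<^esub> b) = c \<otimes>\<^bsub>H\<^esub> d"
      using e(3) gh h that c d inj_onD[OF g] G.m_closed H.m_closed by metis
    ultimately show ?thesis by simp
  qed
  ultimately have "h \<in> iso G H"
    using h by (auto simp: iso_def hom_def)
  then show ?thesis by (rule is_isoI)
qed

text \<open>One class may carry several values of \<open>c\<close>, just as one group has several tables, but each
  value determines the class, so there are at most as many classes as values.\<close>

lemma finite_quotient_of_finite_labels:
  assumes "equiv A r" and "finite (c ` A)"
    and complete: "\<And>x y. x \<in> A \<Longrightarrow> y \<in> A \<Longrightarrow> c x = c y \<Longrightarrow> (x, y) \<in> r"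
  shows "finite (A // r)"
proof (rule finite_subset)
  show "A // r \<subseteq> (\<lambda>t. r `` {inv_into A c t}) ` c ` A"
  proof
    fix B assume "B \<in> A // r"
    then obtain x where x: "x \<in> A" "B = r `` {x}" by (rule quotientE)
    have "inv_into A c (c x) \<in> A" "c (inv_into A c (c x)) = c x"
      using x(1) by (auto intro: inv_into_into f_inv_into_f)
    then have "(x, inv_into A c (c x)) \<in> r" using complete x(1) by simp
    then have "B = r `` {inv_into A c (c x)}"
      using equiv_class_eq[OF assms(1)] x(2) by blast
    then show "B \<in> (\<lambda>t. r `` {inv_into A c t}) ` c ` A" using x(1) by blast
  qed
qed (use assms(2) in blast)

lemma finite_iso_classes_bounded_order:
  fixes \<G> :: "'a monoid set"
  assumes grp: "\<And>G. G \<in> \<G> \<Longrightarrow> group G" and fin: "\<And>G. G \<in> \<G> \<Longrightarrow> finite (carrier G)"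
    and bound: "\<And>G. G \<in> \<G> \<Longrightarrow> order G \<le> N"
  shows "finite (\<G> // iso_rel \<G>)"
proof -
  have "\<exists>f :: 'a \<Rightarrow> nat. inj_on f (carrier G) \<and> f ` carrier G \<subseteq> {..<N}" if "G \<in> \<G>" for G
    using card_le_inj[OF fin[OF that], of "{..<N}"] bound[OF that] by (auto simp: order_def)
  then obtain f :: "'a monoid \<Rightarrow> 'a \<Rightarrow> nat"
    where inj: "\<And>G. G \<in> \<G> \<Longrightarrow> inj_on (f G) (carrier G)"
      and lt: "\<And>G. G \<in> \<G> \<Longrightarrow> f G ` carrier G \<subseteq> {..<N}"
    by metis
  show ?thesis
  proof (rule finite_quotient_of_finite_labels[OF equiv_iso_rel[OF grp]])
    have "mult_table G (f G) \<subseteq> {..<N} \<times> {..<N} \<times> {..<N}" if "G \<in> \<G>" for G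
    proof -
      interpret group G using grp that .
      show ?thesis using lt[OF that] m_closed unfolding mult_table_def by blast
    qed
    then have "(\<lambda>G. mult_table G (f G)) ` \<G> \<subseteq> Pow ({..<N} \<times> {..<N} \<times> {..<N})"
      by blast
    then show "finite ((\<lambda>G. mult_table G (f G)) ` \<G>)"
      by (rule finite_subset) simp
  qed (auto simp: iso_rel_def intro: iso_of_mult_table_eq grp inj)
qed

theorem theorem1p1:
  fixes k :: nat
  shows "finite (SF k :: 'a monoid set set)"
  unfolding SF_def
  by (rule finite_iso_classes_bounded_order[where N = "fact (2 * k) * k"])
     (auto simp: SF_groups_def intro: group.order_le_of_max_degree)

end
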